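(* Let $(X,\mathcal{A},\mu)$ be a measure space with $\mu(X)>0$ such that $X$ is not an atom. Then the annihilator graph $AG(\mathcal{M}(X,\mathcal{A}))$ is hypertriangulated if and only if $\mu$ is non-atomic.
   Context: $\mathcal{M}(X,\mathcal{A})$ is the commutative ring (pointwise operations) of all $\mathcal{A}$-measurable functions $f:X\to\mathbb{R}$; $Z(f)=\{x\in X:f(x)=0\}$. A set $A\in\mathcal{A}$ is an atom if $\mu(A)>0$ and $A$ cannot be written as a disjoint union $A=B\sqcup C$ with $B,C\in\mathcal{A}$, $\mu(B)>0$, $\mu(C)>0$; $\mu$ is non-atomic if $\mathcal{A}$ contains no atom. Write $\mathscr{D}=\{f\in\mathcal{M}(X,\mathcal{A}):\mu(Z(f))>0\text{ and }\mu(X\setminus Z(f))>0\}$, and $ann(f)=\{g\in\mathcal{M}(X,\mathcal{A}): fg=0\ \mu\text{-a.e. on }X\}$. The annihilator graph $AG(\mathcal{M}(X,\mathcal{A}))$ is the simple graph with vertex set $\mathscr{D}$ in which distinct $f,g$ are adjacent iff $ann(f)\cup ann(g)\subsetneqq ann(fg)$. A graph is hypertriangulated if every edge is an edge of a triangle. *)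

theory Defs
  imports "HOL-Analysis.Analysis" "HOL-Algebra.Ring" "Graph_Theory.Pair_Digraph"
begin

definition atom :: "'a measure \<Rightarrow> 'a set \<Rightarrow> bool" where
  "atom M A \<longleftrightarrow> A \<in> sets M \<and> emeasure M A > 0 \<and>
     \<not> (\<exists>B C. B \<in> sets M \<and> C \<in> sets M \<and> A = B \<union> C \<and> B \<inter> C = {} \<and>
             emeasure M B > 0 \<and> emeasure M C > 0)"

definition non_atomic :: "'a measure \<Rightarrow> bool" where
  "non_atomic M \<longleftrightarrow> \<not> (\<exists>A \<in> sets M. atom M A)"

text \<open>
  A function on \<^term>\<open>space M\<close> is represented by its unique extensional representative, so that
  equality in the carrier is equality of functions on \<^term>\<open>space M\<close>. Functions that agree
  almost everywhere are not identified.
\<close>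

definition measurable_ring :: "'a measure \<Rightarrow> ('a \<Rightarrow> real) ring" where
  "measurable_ring M = \<lparr>
     carrier = borel_measurable M \<inter> extensional (space M),
     mult = (\<lambda>f g. \<lambda>x\<in>space M. f x * g x),
     one = (\<lambda>x\<in>space M. 1),
     zero = (\<lambda>x\<in>space M. 0),
     add = (\<lambda>f g. \<lambda>x\<in>space M. f x + g x)\<rparr>"

lemma measurable_ring_cring: "cring (measurable_ring M)"
proof (rule cringI)
  show "abelian_group (measurable_ring M)"
  proof (rule abelian_groupI)
    fix f assume f: "f \<in> carrier (measurable_ring M)"
    show "\<exists>g \<in> carrier (measurable_ring M).
            g \<oplus>\<^bsub>measurable_ring M\<^esub> f = \<zero>\<^bsub>measurable_ring M\<^esub>"
      by (rule bexI[of _ "\<lambda>x\<in>space M. - f x"])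
        (use f in \<open>auto simp: measurable_ring_def fun_eq_iff restrict_def extensional_def
                          cong: measurable_cong\<close>)
  qed (auto simp: measurable_ring_def fun_eq_iff restrict_def extensional_def
            cong: measurable_cong)
  show "Group.comm_monoid (measurable_ring M)"
    by (rule comm_monoidI)
      (auto simp: measurable_ring_def fun_eq_iff restrict_def extensional_def
            cong: measurable_cong)
qed (auto simp: measurable_ring_def fun_eq_iff restrict_def extensional_def algebra_simps)

definition zero_set :: "'a measure \<Rightarrow> ('a \<Rightarrow> real) \<Rightarrow> 'a set" where
  "zero_set M f = {x \<in> space M. f x = 0}"

definition ann :: "'a measure \<Rightarrow> ('a \<Rightarrow> real) \<Rightarrow> ('a \<Rightarrow> real) set" where
  "ann M f = {g \<in> carrier (measurable_ring M).
                AE x in M. (f \<otimes>\<^bsub>measurable_ring M\<^esub> g) x = 0}"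

definition AG_verts :: "'a measure \<Rightarrow> ('a \<Rightarrow> real) set" where
  "AG_verts M = {f \<in> carrier (measurable_ring M).
     emeasure M (zero_set M f) > 0 \<and> emeasure M (space M - zero_set M f) > 0}"

text \<open>
  A (possibly infinite) simple graph is a symmetric loop-free digraph without parallel arcs, that
  is, a \<^locale>\<open>pair_bidirected_digraph\<close>: the undirected edge between \<open>u\<close> and \<open>v\<close>
  is the pair of arcs \<open>(u, v)\<close>, \<open>(v, u)\<close>.
\<close>

definition AG :: "'a measure \<Rightarrow> ('a \<Rightarrow> real) pair_pre_digraph" where
  "AG M = \<lparr> pverts = AG_verts M,
            parcs = {(f, g). f \<in> AG_verts M \<and> g \<in> AG_verts M \<and> f \<noteq> g \<and>
                       ann M f \<union> ann M g \<subset> ann M (f \<otimes>\<^bsub>measurable_ring M\<^esub> g)} \<rparr>"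

lemma AG_simple_graph: "pair_bidirected_digraph (AG M)"
proof -
  have comm: "f \<otimes>\<^bsub>measurable_ring M\<^esub> g = g \<otimes>\<^bsub>measurable_ring M\<^esub> f" for f g
    by (auto simp: measurable_ring_def mult.commute)
  show ?thesis
  proof
    show "symmetric (with_proj (AG M))"
      by (auto simp: AG_def symmetric_def sym_def comm Un_commute)
  qed (auto simp: AG_def)
qed

definition triangle :: "'v pair_pre_digraph \<Rightarrow> 'v \<Rightarrow> 'v \<Rightarrow> 'v \<Rightarrow> bool" where
  "triangle G u v w \<longleftrightarrow> {u, v, w} \<subseteq> pverts G \<and> u \<noteq> v \<and> v \<noteq> w \<and> u \<noteq> w \<and>
     (u, v) \<in> parcs G \<and> (v, w) \<in> parcs G \<and> (u, w) \<in> parcs G"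

definition hypertriangulated :: "'v pair_pre_digraph \<Rightarrow> bool" where
  "hypertriangulated G \<longleftrightarrow> (\<forall>(u, v) \<in> parcs G. \<exists>w. triangle G u v w)"

end

theory Submission
  imports Defs
begin

text \<open>
  Up to null sets a vertex is its cozero set, a measurable set of positive measure whose complement
  has positive measure, and two vertices are adjacent iff neither cozero set is contained almost
  everywhere in the other. If every set of positive measure splits, two such sets \<open>P\<close>, \<open>Q\<close> have a
  common neighbour consisting of one part of \<open>P - Q\<close> and one part of \<open>Q - P\<close>. If \<open>A\<close> is an
  atom, then \<open>A\<close> and its complement are adjacent, and a common neighbour \<open>R\<close> would split \<open>A\<close>
  into \<open>A \<inter> R\<close> and \<open>A - R\<close>.
\<close>

text \<open>Preferred to \<open>zero_set\<close> because products of functions then become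
  intersections of sets, the reals having no zero divisors.\<close>

definition cozero_set :: "'a measure \<Rightarrow> ('a \<Rightarrow> real) \<Rightarrow> 'a set" where
  "cozero_set M f = {x \<in> space M. f x \<noteq> 0}"

text \<open>Restricting to \<open>space M\<close> makes the indicator extensional, hence an element
  of the ring. These functions realize every measurable set as a cozero set.\<close>

definition char_fun :: "'a measure \<Rightarrow> 'a set \<Rightarrow> 'a \<Rightarrow> real" where
  "char_fun M A = (\<lambda>x\<in>space M. indicator A x)"

lemma cozero_set_sets:
  assumes "f \<in> carrier (measurable_ring M)"
  shows "cozero_set M f \<in> sets M"
  using assms by (auto simp: measurable_ring_def cozero_set_def)

lemma mult_in_carrier:
  assumes "f \<in> carrier (measurable_ring M)" "g \<in> carrier (measurable_ring M)"
  shows "f \<otimes>\<^bsub>measurable_ring M\<^esub> g \<in> carrier (measurable_ring M)"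
proof -
  interpret cring "measurable_ring M" by (rule measurable_ring_cring)
  show ?thesis using assms by (rule m_closed)
qed

lemma char_fun_in_carrier:
  assumes "A \<in> sets M"
  shows "char_fun M A \<in> carrier (measurable_ring M)"
  using assms by (auto simp: measurable_ring_def char_fun_def cong: measurable_cong)

lemma cozero_set_char_fun:
  assumes "A \<in> sets M"
  shows "cozero_set M (char_fun M A) = A"
  using sets.sets_into_space[OF assms]
  by (auto simp: cozero_set_def char_fun_def indicator_def)

lemma cozero_set_mult:
  "cozero_set M (f \<otimes>\<^bsub>measurable_ring M\<^esub> g) = cozero_set M f \<inter> cozero_set M g"
  by (auto simp: cozero_set_def measurable_ring_def)

text \<open>A product vanishes almost everywhere iff its cozero set, which is measurable, is null;
  this turns annihilators into conditions on sets.\<close>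

lemma mem_ann_iff:
  assumes "f \<in> carrier (measurable_ring M)"
  shows "g \<in> ann M f \<longleftrightarrow>
    g \<in> carrier (measurable_ring M) \<and> emeasure M (cozero_set M f \<inter> cozero_set M g) = 0"
proof (cases "g \<in> carrier (measurable_ring M)")
  case True
  have "(AE x in M. (f \<otimes>\<^bsub>measurable_ring M\<^esub> g) x = 0) \<longleftrightarrow>
      emeasure M (cozero_set M (f \<otimes>\<^bsub>measurable_ring M\<^esub> g)) = 0"
    using cozero_set_sets[OF mult_in_carrier[OF assms True]]
    by (intro AE_iff_measurable) (auto simp: cozero_set_def)
  with True show ?thesis
    by (simp add: ann_def cozero_set_mult)
qed (simp add: ann_def)

lemma AG_verts_iff:
  "f \<in> AG_verts M \<longleftrightarrow> f \<in> carrier (measurable_ring M) \<and>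
     emeasure M (cozero_set M f) > 0 \<and> emeasure M (space M - cozero_set M f) > 0"
proof -
  have "zero_set M f = space M - cozero_set M f" "space M - zero_set M f = cozero_set M f"
    by (auto simp: zero_set_def cozero_set_def)
  then show ?thesis by (auto simp: AG_verts_def)
qed

lemma char_fun_in_AG_verts_iff:
  assumes "A \<in> sets M"
  shows "char_fun M A \<in> AG_verts M \<longleftrightarrow> emeasure M A > 0 \<and> emeasure M (space M - A) > 0"
  using assms by (simp add: AG_verts_iff char_fun_in_carrier cozero_set_char_fun)

text \<open>
  The characteristic function of the symmetric difference of the two cozero sets is the generic
  element of \<open>ann (f g)\<close> lying in neither \<open>ann f\<close> nor \<open>ann g\<close>.
\<close>

lemma ann_Un_psubset_ann_mult_iff:
  assumes f: "f \<in> carrier (measurable_ring M)" and g: "g \<in> carrier (measurable_ring M)"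
  shows "ann M f \<union> ann M g \<subset> ann M (f \<otimes>\<^bsub>measurable_ring M\<^esub> g) \<longleftrightarrow>
    emeasure M (cozero_set M f - cozero_set M g) > 0 \<and>
    emeasure M (cozero_set M g - cozero_set M f) > 0"
proof -
  let ?P = "cozero_set M f" and ?Q = "cozero_set M g"
  note fg = mult_in_carrier[OF f g]
  have P [measurable]: "?P \<in> sets M" and Q [measurable]: "?Q \<in> sets M"
    using f g by (simp_all add: cozero_set_sets)
  have sub: "ann M f \<union> ann M g \<subseteq> ann M (f \<otimes>\<^bsub>measurable_ring M\<^esub> g)"
  proof
    fix h assume h: "h \<in> ann M f \<union> ann M g"
    then have "h \<in> carrier (measurable_ring M)" by (auto simp: ann_def)
    moreover from this have [measurable]: "cozero_set M h \<in> sets M" by (rule cozero_set_sets)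
    have "emeasure M (?P \<inter> ?Q \<inter> cozero_set M h) \<le> emeasure M (?P \<inter> cozero_set M h)"
      "emeasure M (?P \<inter> ?Q \<inter> cozero_set M h) \<le> emeasure M (?Q \<inter> cozero_set M h)"
      by (auto intro!: emeasure_mono)
    ultimately show "h \<in> ann M (f \<otimes>\<^bsub>measurable_ring M\<^esub> g)"
      using h by (auto simp: mem_ann_iff f g fg cozero_set_mult)
  qed
  \<comment> \<open>The inclusion always holds, so it is strict iff some \<open>h\<close> lies
    outside both smaller annihilators.\<close>
  have "(\<exists>h \<in> ann M (f \<otimes>\<^bsub>measurable_ring M\<^esub> g). h \<notin> ann M f \<and> h \<notin> ann M g) \<longleftrightarrow>
      emeasure M (?P - ?Q) > 0 \<and> emeasure M (?Q - ?P) > 0"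
  proof safe
    fix h assume h: "h \<in> ann M (f \<otimes>\<^bsub>measurable_ring M\<^esub> g)" "h \<notin> ann M f" "h \<notin> ann M g"
    let ?H = "cozero_set M h"
    have [measurable]: "?H \<in> sets M"
      using h(1) by (simp add: mem_ann_iff fg cozero_set_sets)
    \<comment> \<open>Since \<open>h\<close> annihilates the product, deleting this null set leaves
      the measures of \<open>?P \<inter> ?H\<close> and \<open>?Q \<inter> ?H\<close> unchanged, and
      what remains lies in \<open>?P - ?Q\<close> and \<open>?Q - ?P\<close> respectively.\<close>
    have null: "?P \<inter> ?Q \<inter> ?H \<in> null_sets M"
      using h(1) by (auto simp: mem_ann_iff fg cozero_set_mult null_sets_def)
    have "emeasure M (?P \<inter> ?H) > 0" "emeasure M (?Q \<inter> ?H) > 0"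
      using h by (auto simp: mem_ann_iff f g fg zero_less_iff_neq_zero)
    moreover have "emeasure M (?P \<inter> ?H) = emeasure M (?P \<inter> ?H - ?P \<inter> ?Q \<inter> ?H)"
      "emeasure M (?Q \<inter> ?H) = emeasure M (?Q \<inter> ?H - ?P \<inter> ?Q \<inter> ?H)"
      by (simp_all add: emeasure_Diff_null_set[OF null])
    moreover have "\<dots> \<le> emeasure M (?Q - ?P)"
      "emeasure M (?P \<inter> ?H - ?P \<inter> ?Q \<inter> ?H) \<le> emeasure M (?P - ?Q)"
      by (auto intro!: emeasure_mono)
    ultimately show "emeasure M (?P - ?Q) > 0" "emeasure M (?Q - ?P) > 0"
      by (auto intro: less_le_trans)
  next
    assume pos: "emeasure M (?P - ?Q) > 0" "emeasure M (?Q - ?P) > 0"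
    let ?D = "(?P - ?Q) \<union> (?Q - ?P)"
    have D: "?D \<in> sets M" by measurable
    have "?P \<inter> ?Q \<inter> ?D = {}" "?P \<inter> ?D = ?P - ?Q" "?Q \<inter> ?D = ?Q - ?P"
      by auto
    then show "\<exists>h \<in> ann M (f \<otimes>\<^bsub>measurable_ring M\<^esub> g). h \<notin> ann M f \<and> h \<notin> ann M g"
      using pos by (intro bexI[of _ "char_fun M ?D"])
        (simp_all add: mem_ann_iff f g fg cozero_set_mult char_fun_in_carrier[OF D]
          cozero_set_char_fun[OF D] zero_less_iff_neq_zero)
  qed
  with sub show ?thesis by blast
qed

lemma AG_arc_iff:
  "(f, g) \<in> parcs (AG M) \<longleftrightarrow> f \<in> AG_verts M \<and> g \<in> AG_verts M \<and>
     emeasure M (cozero_set M f - cozero_set M g) > 0 \<and>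
     emeasure M (cozero_set M g - cozero_set M f) > 0"
  using ann_Un_psubset_ann_mult_iff[of f M g] by (auto simp: AG_def AG_verts_iff)

lemma AG_triangleI:
  assumes "(f, g) \<in> parcs (AG M)" "(g, h) \<in> parcs (AG M)" "(f, h) \<in> parcs (AG M)"
  shows "triangle (AG M) f g h"
  using assms by (auto simp: triangle_def AG_def)

lemma non_atomic_split:
  assumes "non_atomic M" "A \<in> sets M" "emeasure M A > 0"
  obtains B C where "B \<in> sets M" "C \<in> sets M" "A = B \<union> C" "B \<inter> C = {}"
    "emeasure M B > 0" "emeasure M C > 0"
  using assms unfolding non_atomic_def atom_def by blast

lemma hypertriangulated_if_non_atomic:
  assumes "non_atomic M"
  shows "hypertriangulated (AG M)"
  unfolding hypertriangulated_def
proof clarify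
  fix f g assume fg: "(f, g) \<in> parcs (AG M)"
  let ?P = "cozero_set M f" and ?Q = "cozero_set M g"
  have P: "?P \<in> sets M" and Q: "?Q \<in> sets M"
    using fg by (auto simp: AG_arc_iff AG_verts_iff cozero_set_sets)
  obtain A1 A2 where A: "A1 \<in> sets M" "A2 \<in> sets M" "?P - ?Q = A1 \<union> A2" "A1 \<inter> A2 = {}"
    "emeasure M A1 > 0" "emeasure M A2 > 0"
    using fg P Q by (auto simp: AG_arc_iff intro: non_atomic_split[OF assms, of "?P - ?Q"])
  obtain B1 B2 where B: "B1 \<in> sets M" "B2 \<in> sets M" "?Q - ?P = B1 \<union> B2" "B1 \<inter> B2 = {}"
    "emeasure M B1 > 0" "emeasure M B2 > 0"
    using fg P Q by (auto simp: AG_arc_iff intro: non_atomic_split[OF assms, of "?Q - ?P"])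
  \<comment> \<open>The chosen halves \<open>A1\<close> and \<open>B1\<close> bear witness to
    \<open>?R - ?Q\<close> and \<open>?R - ?P\<close>; the omitted halves \<open>A2\<close> and
    \<open>B2\<close> to \<open>?P - ?R\<close> and \<open>?Q - ?R\<close>. Also \<open>A2\<close>
    keeps the complement of \<open>?R\<close> from being null.\<close>
  let ?R = "A1 \<union> B1"
  have R: "?R \<in> sets M" using A B by auto
  have pos: "emeasure M T > 0" if "emeasure M S > 0" "S \<subseteq> T" "T \<in> sets M" for S T
    using that emeasure_mono[of S T M] by (auto intro: less_le_trans)
  have "emeasure M ?R > 0"
    by (rule pos[OF A(5) _ R]) auto
  moreover have "emeasure M (space M - ?R) > 0"
    by (rule pos[OF A(6)]) (use A B R sets.sets_into_space[OF A(2)] in auto)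
  moreover have "emeasure M (?P - ?R) > 0"
    by (rule pos[OF A(6)]) (use A B P in auto)
  moreover have "emeasure M (?R - ?P) > 0"
    by (rule pos[OF B(5)]) (use A B P in auto)
  moreover have "emeasure M (?Q - ?R) > 0"
    by (rule pos[OF B(6)]) (use A B Q in auto)
  moreover have "emeasure M (?R - ?Q) > 0"
    by (rule pos[OF A(5)]) (use A B Q in auto)
  ultimately have "triangle (AG M) f g (char_fun M ?R)"
    using fg by (intro AG_triangleI)
      (simp_all add: AG_arc_iff char_fun_in_AG_verts_iff[OF R] cozero_set_char_fun[OF R])
  then show "\<exists>h. triangle (AG M) f g h" by blast
qed

text \<open>Otherwise \<open>A \<inter> B\<close> and \<open>A - B\<close> would be a splitting of
  the kind that an atom excludes.\<close>

lemma atom_inter_or_diff_null: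
  assumes "atom M A" "B \<in> sets M"
  shows "emeasure M (A \<inter> B) = 0 \<or> emeasure M (A - B) = 0"
proof (rule ccontr)
  assume "\<not> ?thesis"
  then have "A \<inter> B \<in> sets M \<and> A - B \<in> sets M \<and> A = (A \<inter> B) \<union> (A - B) \<and>
      (A \<inter> B) \<inter> (A - B) = {} \<and> emeasure M (A \<inter> B) > 0 \<and> emeasure M (A - B) > 0"
    using assms by (auto simp: atom_def zero_less_iff_neq_zero)
  then show False using assms(1) unfolding atom_def by blast
qed

text \<open>The assumption that the whole space is not an atom enters here: if the complement of
  \<open>A\<close> were null, a splitting of the space would cut \<open>A\<close> into pieces of the
  same positive measures. Positivity makes the indicators of \<open>A\<close> and its complement
  vertices.\<close>

lemma compl_atom_pos:
  assumes "emeasure M (space M) > 0" "\<not> atom M (space M)" "atom M A"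
  shows "emeasure M (space M - A) > 0"
proof (rule ccontr)
  assume "\<not> ?thesis"
  then have null: "space M - A \<in> null_sets M"
    using assms(3) by (auto simp: atom_def)
  have A: "A \<in> sets M" using assms(3) by (simp add: atom_def)
  obtain B C where BC: "B \<in> sets M" "C \<in> sets M" "space M = B \<union> C" "B \<inter> C = {}"
    "emeasure M B > 0" "emeasure M C > 0"
    using assms(1,2) unfolding atom_def by blast
  have "emeasure M (A \<inter> B) = emeasure M B" "emeasure M (A - B) = emeasure M C"
  proof -
    have "A \<inter> B = B - (space M - A)" "A - B = C - (space M - A)"
      using BC(3,4) sets.sets_into_space[OF A] by auto
    then show "emeasure M (A \<inter> B) = emeasure M B" "emeasure M (A - B) = emeasure M C"
      using emeasure_Diff_null_set[OF null] BC(1,2) by simp_all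
  qed
  with atom_inter_or_diff_null[OF assms(3) BC(1)] BC(5,6) show False by auto
qed

lemma non_atomic_if_hypertriangulated:
  assumes "emeasure M (space M) > 0" "\<not> atom M (space M)" and hyp: "hypertriangulated (AG M)"
  shows "non_atomic M"
  unfolding non_atomic_def
proof clarify
  fix A assume A: "A \<in> sets M" and atom: "atom M A"
  have Ac: "space M - A \<in> sets M" using A by auto
  have sub: "A \<subseteq> space M" using A by (rule sets.sets_into_space)
  have diffs: "A - (space M - A) = A" "space M - A - A = space M - A"
      "space M - (space M - A) = A"
    using sub by auto
  have "emeasure M A > 0" "emeasure M (space M - A) > 0"
    using atom compl_atom_pos[OF assms(1,2) atom] by (auto simp: atom_def)
  then have "(char_fun M A, char_fun M (space M - A)) \<in> parcs (AG M)"
    by (simp add: AG_arc_iff char_fun_in_AG_verts_iff A Ac cozero_set_char_fun diffs)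
  then obtain h where "triangle (AG M) (char_fun M A) (char_fun M (space M - A)) h"
    using hyp unfolding hypertriangulated_def by blast
  \<comment> \<open>The edge from \<open>h\<close> to the indicator of \<open>A\<close> makes
    \<open>A - cozero_set M h\<close> positive; the edge to that of the complement does the same for
    \<open>A \<inter> cozero_set M h\<close>.\<close>
  then have h: "h \<in> AG_verts M" "emeasure M (A - cozero_set M h) > 0"
      "emeasure M (cozero_set M h - (space M - A)) > 0"
    by (auto simp: triangle_def AG_arc_iff cozero_set_char_fun A Ac)
  moreover have "cozero_set M h - (space M - A) = A \<inter> cozero_set M h"
    by (auto simp: cozero_set_def)
  ultimately show False
    using atom_inter_or_diff_null[OF atom, of "cozero_set M h"]
    by (auto simp: AG_verts_iff cozero_set_sets)
qed

theorem theorem4p16: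
  fixes M :: "'a measure"
  assumes "emeasure M (space M) > 0"
    and "\<not> atom M (space M)"
  shows "hypertriangulated (AG M) \<longleftrightarrow> non_atomic M"
  using non_atomic_if_hypertriangulated[OF assms] hypertriangulated_if_non_atomic by blast

end
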